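(* Let $(W,S)$ be a Coxeter system and let $w\in W$ be torically reduced. The following are equivalent: (i) $w$ is torically fully commutative (TFC); (ii) $\mathcal{R}_{\mathrm{tor}}([w])$ is torically order-theoretic; (iii) $\mathcal{R}_{\mathrm{tor}}([w])=\mathcal{L}_{\mathrm{tor}}(\mathcal{T}(\mathsf{u}))$ for some $\mathsf{u}\in\mathcal{R}_{\mathrm{tor}}(w)$; moreover, this holds for some such $\mathsf{u}$ if and only if it holds for every $\mathsf{u}\in\mathcal{R}_{\mathrm{tor}}(w)$.
   Context: $(W,S)$ is a Coxeter system with bond strengths $m(s,t)$ (order of $st$, $m(s,s)=1$) and Coxeter graph $\Gamma$. For distinct $s,t$, $\langle s,t\rangle_k=stst\cdots$ ($k$ letters). A braid relation replaces a consecutive subword $\langle s,t\rangle_{m(s,t)}$ by $\langle t,s\rangle_{m(s,t)}$; short if $m(s,t)=2$. The cyclic word $[\mathsf{w}]$ of a word $\mathsf{w}$ is the set of its cyclic shifts. Two cyclic words differ by a (short) braid if some representative of one is converted into some representative of the other by one (short) braid relation; $\approx$ (resp. $\sim$) is the equivalence on cyclic words generated by braids (resp. short braids). A word is torically reduced if it remains reduced under any sequence of cyclic shifts and/or braid relations; an element $w\in W$ is torically reduced if any (equivalently every) reduced word for it is. For torically reduced $w$ with a reduced word $\mathsf{w}$: $\mathcal{R}_{\mathrm{tor}}([w])=\{[\mathsf{u}]:[\mathsf{u}]\approx[\mathsf{w}]\}$ and $\mathcal{R}_{\mathrm{tor}}(w)=\{\mathsf{u}\in S^*:[\mathsf{u}]\in\mathcal{R}_{\mathrm{tor}}([w])\}$;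 the cyclic commutativity class of $[\mathsf{w}]$ is $\{[\mathsf{u}]:[\mathsf{u}]\sim[\mathsf{w}]\}$, and $\mathcal{R}_{\mathrm{tor}}([w])$ is a disjoint union of cyclic commutativity classes. $w$ is TFC if it is torically reduced and $\mathcal{R}_{\mathrm{tor}}([w])$ consists of a single cyclic commutativity class. Toric posets and heaps: for a finite graph $G$ and acyclic orientation $\omega$, source-to-sink conversions generate an equivalence $\equiv$; the class is the toric poset $T(G,[\omega])$. For $\mathsf{w}=s_{x_1}\cdots s_{x_m}$, let $G_\mathsf{w}$ be the graph on $[m]$ with an edge $\{i,j\}$ for $i\ne j$ with $m(s_{x_i},s_{x_j})\neq 2$, oriented $i\to j$ for $i<j$ (orientation $\omega_\mathsf{w}$); the toric heap is $\mathcal{T}(\mathsf{w})=(T(G_\mathsf{w},[\omega_\mathsf{w}]),\Gamma,i\mapsto s_{x_i})$. A total toric extension of $\mathcal{T}(\mathsf{w})$ is a linear ordering $(i_1,\dots,i_m)$ of $[m]$ up to cyclic rotation such that the orientation of $K_m$ it induces ($i_a\to i_b$ for $a<b$), restricted to the edges of $G_\mathsf{w}$, is toric equivalent to $\omega_\mathsf{w}$; it is recorded as the cyclic word $[s_{x_{i_1}}\cdots s_{x_{i_m}}]$, and $\mathcal{L}_{\mathrm{tor}}(\mathcal{T}(\mathsf{w}))$ is the set of all such cyclic words. A set of cyclic words is torically order-theoretic if it equals $\mathcal{L}_{\mathrm{tor}}(\mathcal{T}(\mathsf{u}))$ for some torically reduced word $\mathsf{u}$. *)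

theory Defs
  imports "HOL-Algebra.Generated_Groups" "HOL-Algebra.Multiplicative_Group"
begin

section \<open>Coxeter systems\<close>

definition (in monoid) word_prod :: "'a list \<Rightarrow> 'a" where
  "word_prod u = foldr (\<otimes>) u \<one>"

text \<open>
  \<^const>\<open>group.ord\<close> is \<open>0\<close> on elements of infinite order, so \<open>bond s t = 0\<close> encodes
  the bond strength \<open>\<infinity>\<close>.
\<close>

definition (in group) bond :: "'a \<Rightarrow> 'a \<Rightarrow> nat" where
  "bond s t = ord (s \<otimes> t)"

definition (in group) relator_step :: "'a set \<Rightarrow> 'a list \<Rightarrow> 'a list \<Rightarrow> bool" where
  "relator_step S u v \<longleftrightarrow>
     (\<exists>x y s t. x \<in> lists S \<and> y \<in> lists S \<and> s \<in> S \<and> t \<in> S \<and> bond s t \<noteq> 0 \<and>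
        u = x @ concat (replicate (bond s t) [s, t]) @ y \<and> v = x @ y)"

text \<open>
  The assumption \<open>presentation\<close> says that \<open>W\<close> is presented by the generators \<open>S\<close> and the
  relations \<open>(s t)^m(s,t) = 1\<close> with \<open>m(s,t)\<close> finite. Since \<open>m(s,s) = 1\<close>, the relators
  include all words \<open>s s\<close>, so every generator is its own inverse in the monoid with this
  presentation; hence the monoid presentation and the group presentation agree, and plain
  words over \<open>S\<close> suffice.
\<close>

locale coxeter_system = group W for W (structure) +
  fixes S :: "'a set"
  assumes generators_subset: "S \<subseteq> carrier W"
    and generators_involutive: "s \<in> S \<Longrightarrow> s \<noteq> \<one> \<and> s \<otimes> s = \<one>"
    and generated: "generate W S = carrier W"
    and presentation:
      "\<lbrakk>u \<in> lists S; v \<in> lists S\<rbrakk> \<Longrightarrow>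
         word_prod u = word_prod v \<longleftrightarrow> equivclp (relator_step S) u v"

type_synonym 'v ugraph = "'v set \<times> 'v set set"

definition (in coxeter_system) coxeter_graph :: "'a ugraph \<times> ('a \<Rightarrow> 'a \<Rightarrow> nat)" where
  "coxeter_graph = ((S, {{s, t} | s t. s \<in> S \<and> t \<in> S \<and> s \<noteq> t \<and> bond s t \<noteq> 2}), bond)"


section \<open>Words, braids and cyclic words\<close>

fun alternating :: "'a \<Rightarrow> 'a \<Rightarrow> nat \<Rightarrow> 'a list" where
  "alternating s t 0 = []"
| "alternating s t (Suc k) = s # alternating t s k"

definition cyclic_word :: "'a list \<Rightarrow> 'a list set" where
  "cyclic_word u = {rotate k u | k. True}"

context coxeter_system
begin

definition reduced :: "'a list \<Rightarrow> bool" where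
  "reduced u \<longleftrightarrow> u \<in> lists S \<and>
     (\<forall>v \<in> lists S. word_prod v = word_prod u \<longrightarrow> length u \<le> length v)"

definition reduced_words :: "'a \<Rightarrow> 'a list set" where
  "reduced_words w = {u. reduced u \<and> word_prod u = w}"

definition braid :: "'a list \<Rightarrow> 'a list \<Rightarrow> bool" where
  "braid u v \<longleftrightarrow>
     (\<exists>x y s t. x \<in> lists S \<and> y \<in> lists S \<and> s \<in> S \<and> t \<in> S \<and> s \<noteq> t \<and> bond s t \<noteq> 0 \<and>
        u = x @ alternating s t (bond s t) @ y \<and>
        v = x @ alternating t s (bond s t) @ y)"

definition short_braid :: "'a list \<Rightarrow> 'a list \<Rightarrow> bool" where
  "short_braid u v \<longleftrightarrow>
     (\<exists>x y s t. x \<in> lists S \<and> y \<in> lists S \<and> s \<in> S \<and> t \<in> S \<and> s \<noteq> t \<and> bond s t = 2 \<and>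
        u = x @ alternating s t 2 @ y \<and>
        v = x @ alternating t s 2 @ y)"

definition cyclic_braid :: "'a list set \<Rightarrow> 'a list set \<Rightarrow> bool" where
  "cyclic_braid A B \<longleftrightarrow> (\<exists>u v. A = cyclic_word u \<and> B = cyclic_word v \<and> braid u v)"

definition cyclic_short_braid :: "'a list set \<Rightarrow> 'a list set \<Rightarrow> bool" where
  "cyclic_short_braid A B \<longleftrightarrow>
     (\<exists>u v. A = cyclic_word u \<and> B = cyclic_word v \<and> short_braid u v)"

abbreviation cyclic_braid_equiv :: "'a list set \<Rightarrow> 'a list set \<Rightarrow> bool" (infix "\<approx>" 50) where
  "A \<approx> B \<equiv> equivclp cyclic_braid A B"

abbreviation cyclic_comm_equiv :: "'a list set \<Rightarrow> 'a list set \<Rightarrow> bool" (infix "\<sim>" 50) where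
  "A \<sim> B \<equiv> equivclp cyclic_short_braid A B"

definition cyclic_comm_class :: "'a list set \<Rightarrow> 'a list set set" where
  "cyclic_comm_class A = {B. B \<sim> A}"

definition torically_reduced_word :: "'a list \<Rightarrow> bool" where
  "torically_reduced_word u \<longleftrightarrow> u \<in> lists S \<and>
     (\<forall>v. (\<lambda>x y. (\<exists>k. y = rotate k x) \<or> braid x y)\<^sup>*\<^sup>* u v \<longrightarrow> reduced v)"

definition torically_reduced :: "'a \<Rightarrow> bool" where
  "torically_reduced w \<longleftrightarrow>
     w \<in> carrier W \<and> (\<forall>u \<in> reduced_words w. torically_reduced_word u)"

text \<open>
  By Matsumoto's theorem all reduced words of \<open>w\<close> are connected by braid relations, so
  \<open>Rtor w\<close> is the \<open>\<approx>\<close>-class of the cyclic word of any single reduced word of \<open>w\<close>.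
\<close>

definition Rtor :: "'a \<Rightarrow> 'a list set set" where
  "Rtor w = {cyclic_word u | u. u \<in> lists S \<and>
               (\<exists>v \<in> reduced_words w. cyclic_word u \<approx> cyclic_word v)}"

definition Rtor_words :: "'a \<Rightarrow> 'a list set" where
  "Rtor_words w = {u \<in> lists S. cyclic_word u \<in> Rtor w}"

definition TFC :: "'a \<Rightarrow> bool" where
  "TFC w \<longleftrightarrow> torically_reduced w \<and>
     (\<exists>u \<in> lists S. Rtor w = cyclic_comm_class (cyclic_word u))"

end


section \<open>Toric posets\<close>

definition orientation :: "'v ugraph \<Rightarrow> 'v rel \<Rightarrow> bool" where
  "orientation G \<omega> \<longleftrightarrow>
     (\<forall>i j. (i, j) \<in> \<omega> \<longrightarrow> {i, j} \<in> snd G) \<and>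
     (\<forall>i j. {i, j} \<in> snd G \<longrightarrow> ((i, j) \<in> \<omega> \<longleftrightarrow> (j, i) \<notin> \<omega>))"

definition acyclic_orientation :: "'v ugraph \<Rightarrow> 'v rel \<Rightarrow> bool" where
  "acyclic_orientation G \<omega> \<longleftrightarrow> orientation G \<omega> \<and> acyclic \<omega>"

definition source_to_sink :: "'v ugraph \<Rightarrow> 'v rel \<Rightarrow> 'v rel \<Rightarrow> bool" where
  "source_to_sink G \<omega> \<omega>' \<longleftrightarrow> acyclic_orientation G \<omega> \<and>
     (\<exists>v \<in> fst G. (\<forall>u. (u, v) \<notin> \<omega>) \<and>
        \<omega>' = {(a, b) \<in> \<omega>. a \<noteq> v} \<union> {(b, v) | b. (v, b) \<in> \<omega>})"

definition toric_class :: "'v ugraph \<Rightarrow> 'v rel \<Rightarrow> 'v rel set" where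
  "toric_class G \<omega> = {\<omega>'. equivclp (source_to_sink G) \<omega>' \<omega>}"

type_synonym 'v toric_poset = "'v ugraph \<times> 'v rel set"

definition toric_poset :: "'v ugraph \<Rightarrow> 'v rel \<Rightarrow> 'v toric_poset" where
  "toric_poset G \<omega> = (G, toric_class G \<omega>)"

definition ordering_orientation :: "'v list \<Rightarrow> 'v rel" where
  "ordering_orientation p = {(p ! a, p ! b) | a b. a < b \<and> b < length p}"

definition restrict_orientation :: "'v ugraph \<Rightarrow> 'v rel \<Rightarrow> 'v rel" where
  "restrict_orientation G \<omega> = {(i, j) \<in> \<omega>. {i, j} \<in> snd G}"

definition total_toric_extensions :: "'v toric_poset \<Rightarrow> 'v list set set" where
  "total_toric_extensions P = (case P of (G, C) \<Rightarrow>
     {cyclic_word p | p. distinct p \<and> set p = fst G \<and>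
        restrict_orientation G (ordering_orientation p) \<in> C})"


section \<open>Toric heaps\<close>

type_synonym ('v, 's) toric_heap =
  "'v toric_poset \<times> ('s ugraph \<times> ('s \<Rightarrow> 's \<Rightarrow> nat)) \<times> ('v \<Rightarrow> 's)"

definition Ltor :: "('v, 's) toric_heap \<Rightarrow> 's list set set" where
  "Ltor H = (case H of (P, \<Gamma>, label) \<Rightarrow>
     {cyclic_word (map label p) | p. cyclic_word p \<in> total_toric_extensions P})"

context coxeter_system
begin

text \<open>Positions in a word of length \<open>m\<close> are \<open>0, \<dots>, m - 1\<close>.\<close>

definition word_graph :: "'a list \<Rightarrow> nat ugraph" where
  "word_graph u = ({..<length u},
     {{i, j} | i j. i < length u \<and> j < length u \<and> i \<noteq> j \<and> bond (u ! i) (u ! j) \<noteq> 2})"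

definition word_orientation :: "'a list \<Rightarrow> nat rel" where
  "word_orientation u = {(i, j). i < j \<and> {i, j} \<in> snd (word_graph u)}"

definition toric_heap :: "'a list \<Rightarrow> (nat, 'a) toric_heap" where
  "toric_heap u =
     (toric_poset (word_graph u) (word_orientation u), coxeter_graph, (\<lambda>i. u ! i))"

definition torically_order_theoretic :: "'a list set set \<Rightarrow> bool" where
  "torically_order_theoretic X \<longleftrightarrow>
     (\<exists>u. torically_reduced_word u \<and> X = Ltor (toric_heap u))"

end

end

theory Submission
  imports Defs
begin

(* The total toric extensions of the toric heap of a word u are exactly the members of the cyclic
   commutativity class of [u]: a rotation of a linear ordering is a source-to-sink conversion of
   the induced orientation, and two orderings inducing the same orientation on the edges of the
   word graph differ by commutations of adjacent letters. Hence Rtor w is torically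
   order-theoretic precisely when it is a single cyclic commutativity class. *)

section \<open>Equivalence closures and cyclic words\<close>

lemma equivclp_map:
  assumes "equivclp r a b" and "\<And>x y. r x y \<Longrightarrow> R (f x) (f y)"
  shows "equivclp R (f a) (f b)"
  using assms(1)
proof (induction rule: equivclp_induct)
  case base
  show ?case by simp
next
  case (step y z)
  then show ?case
    using assms(2) by (meson equivclp_into_equivclp)
qed

text \<open>The exponents add up to \<open>k * length u\<close>, a whole number of turns, so the
  first one stands in for \<open>- k\<close> in the natural numbers. For empty \<open>u\<close>
  every rotation is trivial.\<close>

lemma rotate_inverse: "rotate (k * (length u - 1)) (rotate k u) = u"
proof (cases u)
  case (Cons a u')
  have "k * (length u - 1) + k = k * length u"
    using Cons by simp
  then show ?thesis
    by (simp only: rotate_rotate rotate_id mod_mult_self2_is_0)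
qed simp

lemma cyclic_word_rotate: "cyclic_word (rotate k u) = cyclic_word u"
proof
  show "cyclic_word (rotate k u) \<subseteq> cyclic_word u"
    by (auto simp: cyclic_word_def rotate_rotate)
  have "rotate j u = rotate (j + k * (length u - 1)) (rotate k u)" for j
    by (simp only: rotate_inverse rotate_rotate[symmetric])
  then show "cyclic_word u \<subseteq> cyclic_word (rotate k u)"
    unfolding cyclic_word_def by blast
qed

lemma cyclic_word_eqD: "cyclic_word u = cyclic_word v \<Longrightarrow> \<exists>k. v = rotate k u"
proof -
  assume "cyclic_word u = cyclic_word v"
  moreover have "rotate 0 v \<in> cyclic_word v"
    unfolding cyclic_word_def by blast
  ultimately show ?thesis
    by (auto simp: cyclic_word_def)
qed

lemma cyclic_word_snoc: "cyclic_word (u @ [a]) = cyclic_word (a # u)"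
  using cyclic_word_rotate[of 1 "a # u"] by simp

lemma rotate_in_lists: "u \<in> lists A \<Longrightarrow> rotate k u \<in> lists A"
  by (simp add: in_lists_conv_set)


section \<open>Orientations induced by linear orderings\<close>

lemma ordering_orientation_Nil [simp]: "ordering_orientation [] = {}"
  by (simp add: ordering_orientation_def)

text \<open>Replaces the indices of the definition by recursion, so that later facts on orderings go
  by list induction.\<close>

lemma ordering_orientation_Cons [simp]:
  "ordering_orientation (x # p) = {x} \<times> set p \<union> ordering_orientation p"
proof (intro equalityI subsetI)
  fix e assume "e \<in> ordering_orientation (x # p)"
  then obtain a b where ab: "e = ((x # p) ! a, (x # p) ! b)" "a < b" "b < length (x # p)"
    by (auto simp: ordering_orientation_def)
  then obtain b' where b': "b = Suc b'"
    by (cases b) auto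
  show "e \<in> {x} \<times> set p \<union> ordering_orientation p"
    using ab b' by (cases a) (auto simp: ordering_orientation_def)
next
  fix e assume "e \<in> {x} \<times> set p \<union> ordering_orientation p"
  then consider b where "e = (x, p ! b)" "b < length p"
    | a b where "e = (p ! a, p ! b)" "a < b" "b < length p"
    by (auto simp: ordering_orientation_def in_set_conv_nth)
  then show "e \<in> ordering_orientation (x # p)"
  proof cases
    case 1
    then have "e = ((x # p) ! 0, (x # p) ! Suc b) \<and> 0 < Suc b \<and> Suc b < length (x # p)"
      by simp
    then show ?thesis
      unfolding ordering_orientation_def by blast
  next
    case 2
    then have "e = ((x # p) ! Suc a, (x # p) ! Suc b) \<and> Suc a < Suc b \<and> Suc b < length (x # p)"
      by simp
    then show ?thesis
      unfolding ordering_orientation_def by blast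
  qed
qed

lemma ordering_orientation_append [simp]:
  "ordering_orientation (p @ q) =
     ordering_orientation p \<union> ordering_orientation q \<union> set p \<times> set q"
  by (induction p) auto

lemma ordering_orientation_subset: "ordering_orientation p \<subseteq> set p \<times> set p"
  by (induction p) auto

lemma ordering_orientation_fieldD:
  "(i, j) \<in> ordering_orientation p \<Longrightarrow> i \<in> set p \<and> j \<in> set p"
  using ordering_orientation_subset by fastforce

lemma ordering_orientation_irrefl:
  "distinct p \<Longrightarrow> (i, i) \<notin> ordering_orientation p"
  by (induction p) auto

lemma ordering_orientation_asym:
  "distinct p \<Longrightarrow> (i, j) \<in> ordering_orientation p \<Longrightarrow> (j, i) \<notin> ordering_orientation p"
  by (induction p) (auto dest: ordering_orientation_fieldD)

lemma ordering_orientation_total: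
  "i \<in> set p \<Longrightarrow> j \<in> set p \<Longrightarrow> i \<noteq> j \<Longrightarrow>
     (i, j) \<in> ordering_orientation p \<or> (j, i) \<in> ordering_orientation p"
  by (induction p) auto

lemma ordering_orientation_upt: "ordering_orientation [0..<m] = {(i, j). i < j \<and> j < m}"
proof -
  have "(i, j) \<in> ordering_orientation [0..<m]" if "i < j" "j < m" for i j
    unfolding ordering_orientation_def
    by (rule CollectI, rule exI[of _ i], rule exI[of _ j]) (use that in simp)
  moreover have "i < j \<and> j < m" if "(i, j) \<in> ordering_orientation [0..<m]" for i j
    using that by (auto simp: ordering_orientation_def)
  ultimately show ?thesis
    by blast
qed

section \<open>Restriction to a graph, acyclicity and source-to-sink conversions\<close>

lemma orientation_restrict_ordering:
  assumes "distinct p" and "\<Union> (snd G) \<subseteq> set p" and "\<And>i. {i} \<notin> snd G"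
  shows "orientation G (restrict_orientation G (ordering_orientation p))"
  unfolding orientation_def
proof (intro conjI allI impI)
  fix i j
  show "{i, j} \<in> snd G" if "(i, j) \<in> restrict_orientation G (ordering_orientation p)"
    using that by (simp add: restrict_orientation_def)
  assume e: "{i, j} \<in> snd G"
  then have "i \<in> set p" "j \<in> set p" "i \<noteq> j"
    using assms by auto
  then show "(i, j) \<in> restrict_orientation G (ordering_orientation p) \<longleftrightarrow>
      (j, i) \<notin> restrict_orientation G (ordering_orientation p)"
    using e ordering_orientation_total[of i p j] ordering_orientation_asym[OF assms(1)]
    by (auto simp: restrict_orientation_def insert_commute)
qed

text \<open>No edge enters the head of the list, so a closed path avoids it and lies in the
  orientation of the tail, where induction applies.\<close>

lemma acyclic_ordering_orientation:
  assumes "distinct p"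
  shows "acyclic (ordering_orientation p)"
  using assms
proof (induction p)
  case Nil
  show ?case by (simp add: acyclic_def)
next
  case (Cons x p)
  have field: "(i, j) \<in> (ordering_orientation (x # p))\<^sup>+ \<Longrightarrow> j \<in> set p" for i j
    by (induction rule: trancl_induct) (auto dest: ordering_orientation_fieldD)
  have lift: "(i, j) \<in> (ordering_orientation (x # p))\<^sup>+ \<Longrightarrow> i \<noteq> x \<Longrightarrow>
      (i, j) \<in> (ordering_orientation p)\<^sup>+" for i j
  proof (induction rule: trancl_induct)
    case (base y)
    then show ?case by auto
  next
    case (step y z)
    then have "(y, z) \<in> ordering_orientation p"
      using field[OF step.hyps(1)] Cons.prems by auto
    with step show ?case
      by (meson trancl.trancl_into_trancl)
  qed
  show ?case
    unfolding acyclic_def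
  proof (intro allI notI)
    fix i assume i: "(i, i) \<in> (ordering_orientation (x # p))\<^sup>+"
    then have "i \<noteq> x"
      using field Cons.prems by auto
    then show False
      using lift[OF i] Cons by (auto simp: acyclic_def)
  qed
qed

text \<open>\<open>v\<close> precedes all other entries in \<open>v # p\<close> and follows them in
  \<open>p @ [v]\<close>, while the other pairs keep their order. The first equation has the shape
  of \<open>source_to_sink\<close>; the second undoes it.\<close>

lemma restrict_ordering_rotate:
  assumes "distinct (v # p)"
  shows "restrict_orientation G (ordering_orientation (p @ [v])) =
      {(a, b) \<in> restrict_orientation G (ordering_orientation (v # p)). a \<noteq> v} \<union>
      {(b, v) | b. (v, b) \<in> restrict_orientation G (ordering_orientation (v # p))}"
    and "restrict_orientation G (ordering_orientation (v # p)) =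
      {(a, b) \<in> restrict_orientation G (ordering_orientation (p @ [v])). b \<noteq> v} \<union>
      {(v, b) | b. (b, v) \<in> restrict_orientation G (ordering_orientation (p @ [v]))}"
  using assms by (auto simp: restrict_orientation_def insert_commute
      dest: ordering_orientation_fieldD)

lemma source_to_sink_rotate:
  assumes p: "distinct (v # p)" and G: "fst G = set (v # p)"
    "\<Union> (snd G) \<subseteq> fst G" "\<And>i. {i} \<notin> snd G"
  shows "source_to_sink G (restrict_orientation G (ordering_orientation (v # p)))
           (restrict_orientation G (ordering_orientation (p @ [v])))"
proof -
  have "acyclic (restrict_orientation G (ordering_orientation (v # p)))"
    by (rule acyclic_subset[OF acyclic_ordering_orientation[OF p]])
      (auto simp: restrict_orientation_def)
  then have "acyclic_orientation G (restrict_orientation G (ordering_orientation (v # p)))"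
    using orientation_restrict_ordering[OF p] G by (simp add: acyclic_orientation_def)
  moreover have "\<forall>u. (u, v) \<notin> restrict_orientation G (ordering_orientation (v # p))"
    using p by (auto simp: restrict_orientation_def dest: ordering_orientation_fieldD)
  ultimately show ?thesis
    unfolding source_to_sink_def using G restrict_ordering_rotate(1)[OF p] by auto
qed

lemma toric_class_trans:
  "\<lbrakk>\<omega> \<in> toric_class G \<omega>0; equivclp (source_to_sink G) \<omega> \<omega>'\<rbrakk> \<Longrightarrow> \<omega>' \<in> toric_class G \<omega>0"
  unfolding toric_class_def by (metis equivclp_sym equivclp_trans mem_Collect_eq)


section \<open>Bonds, braids and commutation of letters\<close>

context coxeter_system
begin

text \<open>Generators are involutions, so the two products are inverse to each other and have the
  same order.\<close>

lemma bond_commute: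
  assumes "s \<in> S" "t \<in> S" shows "bond s t = bond t s"
proof -
  have st: "s \<in> carrier W" "t \<in> carrier W" "inv s = s" "inv t = t"
    using assms generators_subset generators_involutive by (auto intro!: inv_equality)
  then have "t \<otimes> s = inv (s \<otimes> t)"
    by (simp add: inv_mult_group)
  then show ?thesis
    unfolding bond_def using st by (metis m_closed ord_inv)
qed

text \<open>A generator times itself is the identity, which has order 1.\<close>

lemma bond_2_neq: "s \<in> S \<Longrightarrow> bond s t = 2 \<Longrightarrow> s \<noteq> t"
  using generators_involutive[of s] by (auto simp: bond_def ord_id)

lemma braid_sym: "braid u v \<Longrightarrow> braid v u"
  unfolding braid_def by (metis bond_commute)

lemma braid_in_lists: "braid u v \<Longrightarrow> u \<in> lists S \<and> v \<in> lists S"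
proof -
  have "alternating s t k \<in> lists S" if "s \<in> S" "t \<in> S" for s t k
    using that by (induction k arbitrary: s t) auto
  then show "braid u v \<Longrightarrow> u \<in> lists S \<and> v \<in> lists S"
    unfolding braid_def by (metis append_in_lists_conv)
qed

lemma short_braid_iff:
  "short_braid u v \<longleftrightarrow>
     (\<exists>x y s t. x \<in> lists S \<and> y \<in> lists S \<and> s \<in> S \<and> t \<in> S \<and> bond s t = 2 \<and>
        u = x @ s # t # y \<and> v = x @ t # s # y)"
  unfolding short_braid_def using bond_2_neq by (fastforce simp: numeral_2_eq_2)

lemma short_braid_sym: "short_braid u v \<Longrightarrow> short_braid v u"
  unfolding short_braid_iff by (metis bond_commute)

lemma short_braid_Cons:
  assumes "short_braid u v" "s \<in> S" shows "short_braid (s # u) (s # v)"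
proof -
  obtain x y a b where "x \<in> lists S" "y \<in> lists S" "a \<in> S" "b \<in> S" "bond a b = 2"
    "u = x @ a # b # y" "v = x @ b # a # y"
    using assms(1) by (auto simp: short_braid_iff)
  with assms(2) show ?thesis
    unfolding short_braid_iff
    by (intro exI[of _ "s # x"] exI[of _ y] exI[of _ a] exI[of _ b]) simp
qed

lemma equivclp_short_braid_Cons:
  "equivclp short_braid u v \<Longrightarrow> s \<in> S \<Longrightarrow> equivclp short_braid (s # u) (s # v)"
  by (erule equivclp_map) (rule short_braid_Cons)

lemma equivclp_short_braid_move_front:
  assumes "x \<in> lists S" "y \<in> lists S" "s \<in> S" "\<And>t. t \<in> set x \<Longrightarrow> bond t s = 2"
  shows "equivclp short_braid (x @ s # y) (s # x @ y)"
  using assms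
proof (induction x)
  case (Cons t x)
  then have "equivclp short_braid (t # x @ s # y) (t # s # x @ y)"
    by (intro equivclp_short_braid_Cons) auto
  moreover have "short_braid (t # s # x @ y) (s # t # x @ y)"
    unfolding short_braid_iff
    by (rule exI[of _ "[]"], rule exI[of _ "x @ y"], rule exI[of _ t], rule exI[of _ s])
      (use Cons.hyps Cons.prems in simp)
  ultimately show ?case
    by (simp add: equivclp_into_equivclp)
qed simp

text \<open>Induction on \<open>q\<close>: its first entry \<open>v\<close> can be commuted to the
  front of \<open>p\<close>, after which both orderings start with \<open>v\<close> and the
  remainders are compared.\<close>

lemma equivclp_short_braid_orderings:
  assumes "distinct p" "distinct q" "set p = set q" "l ` set q \<subseteq> S"
    and "\<And>i j. i \<in> set q \<Longrightarrow> j \<in> set q \<Longrightarrow> bond (l i) (l j) \<noteq> 2 \<Longrightarrow>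
           (i, j) \<in> ordering_orientation p \<longleftrightarrow> (i, j) \<in> ordering_orientation q"
  shows "equivclp short_braid (map l p) (map l q)"
  using assms
proof (induction q arbitrary: p)
  case Nil
  then show ?case by simp
next
  case (Cons v q)
  then obtain a b where p: "p = a @ v # b"
    by (metis list.set_intros(1) split_list)
  have set: "set (a @ b) = set q"
    using Cons.prems(1-3) p by auto
  \<comment> \<open>A non-commuting \<open>x\<close> before \<open>v\<close> in \<open>p\<close>
    would also come before \<open>v\<close> in \<open>v # q\<close>, where \<open>v\<close> is
    first.\<close>
  have "bond (l x) (l v) = 2" if "x \<in> set a" for x
  proof (rule ccontr)
    assume "bond (l x) (l v) \<noteq> 2"
    then have "(x, v) \<in> ordering_orientation (v # q)"
      using Cons.prems(5)[of x v] that p set by auto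
    then show False
      using Cons.prems(1,2) that p by (auto dest: ordering_orientation_fieldD)
  qed
  moreover have "l ` set (a @ b) \<subseteq> S"
    unfolding set using Cons.prems(4) by auto
  then have "map l a \<in> lists S" "map l b \<in> lists S" "l v \<in> S"
    using Cons.prems(4) by (simp_all add: image_subset_iff in_lists_conv_set)
  ultimately have "equivclp short_braid (map l p) (map l (v # a @ b))"
    using equivclp_short_braid_move_front[of "map l a" "map l b" "l v"] by (auto simp: p)
  \<comment> \<open>Deleting \<open>v\<close> leaves the relative order of the other entries
    unchanged, so the agreement hypothesis passes to the remainders.\<close>
  moreover have "equivclp short_braid (map l (a @ b)) (map l q)"
  proof (rule Cons.IH)
    fix i j assume ij: "i \<in> set q" "j \<in> set q" "bond (l i) (l j) \<noteq> 2"
    then have "i \<noteq> v" "j \<noteq> v"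
      using Cons.prems(2) by auto
    then show "(i, j) \<in> ordering_orientation (a @ b) \<longleftrightarrow> (i, j) \<in> ordering_orientation q"
      using Cons.prems(5)[of i j] ij by (auto simp: p)
  qed (use Cons.prems p set in auto)
  then have "equivclp short_braid (map l (v # a @ b)) (map l (v # q))"
    using equivclp_short_braid_Cons \<open>l v \<in> S\<close> by simp
  ultimately show ?case
    by (rule equivclp_trans)
qed

lemma cyclic_comm_equivI:
  "equivclp short_braid u v \<Longrightarrow> cyclic_word u \<sim> cyclic_word v"
  by (erule equivclp_map) (auto simp: cyclic_short_braid_def)

section \<open>Word graphs and the orderings of a toric heap\<close>

lemma word_graph_facts:
  shows "fst (word_graph u) = {..<length u}"
    and "\<Union> (snd (word_graph u)) \<subseteq> fst (word_graph u)"
    and "{i} \<notin> snd (word_graph u)"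
  by (auto simp: word_graph_def doubleton_eq_iff)

text \<open>An edge is an unordered pair witnessed in one of its two orders; symmetry of
  \<open>bond\<close> on \<open>S\<close> lets the test be made in either.\<close>

lemma word_graph_edge_iff:
  assumes "u \<in> lists S"
  shows "{i, j} \<in> snd (word_graph u) \<longleftrightarrow>
           i < length u \<and> j < length u \<and> i \<noteq> j \<and> bond (u ! i) (u ! j) \<noteq> 2"
proof -
  have "bond (u ! i) (u ! j) = bond (u ! j) (u ! i)" if "i < length u" "j < length u"
    using that assms by (intro bond_commute) auto
  then show ?thesis
    by (auto simp: word_graph_def doubleton_eq_iff)
qed

lemma word_orientation_eq_restrict:
  "word_orientation u =
     restrict_orientation (word_graph u) (ordering_orientation [0..<length u])"
  unfolding word_orientation_def restrict_orientation_def ordering_orientation_upt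
  using word_graph_facts(1,2)[of u] by auto

definition heap_orientation :: "'a list \<Rightarrow> nat list \<Rightarrow> nat rel" where
  "heap_orientation u p = restrict_orientation (word_graph u) (ordering_orientation p)"

text \<open>A single linear representative of a total toric extension, before passing to its
  rotation class.\<close>

definition toric_ordering :: "'a list \<Rightarrow> nat list \<Rightarrow> bool" where
  "toric_ordering u p \<longleftrightarrow> distinct p \<and> set p = {..<length u} \<and>
     heap_orientation u p \<in> toric_class (word_graph u) (word_orientation u)"

lemma heap_orientation_iff:
  assumes "u \<in> lists S" "distinct p" "set p = {..<length u}"
  shows "(i, j) \<in> heap_orientation u p \<longleftrightarrow>
           (i, j) \<in> ordering_orientation p \<and> bond (u ! i) (u ! j) \<noteq> 2"
  unfolding heap_orientation_def restrict_orientation_def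
  using word_graph_edge_iff[OF assms(1)] ordering_orientation_fieldD[of i j p]
    ordering_orientation_irrefl[OF assms(2)] assms(3) by auto

text \<open>If no edge joins \<open>v\<close> to the block it jumps over, all letters of the block
  commute with the letter at \<open>v\<close>, so only pairs that are not edges change their order.
  One form serves sources, the other sinks.\<close>

lemma heap_orientation_move:
  assumes u: "u \<in> lists S" and p: "distinct (a @ v # b)" "set (a @ v # b) = {..<length u}"
  shows heap_orientation_move_first:
      "(\<And>x. x \<in> set a \<Longrightarrow> (x, v) \<notin> heap_orientation u (a @ v # b)) \<Longrightarrow>
         heap_orientation u (v # a @ b) = heap_orientation u (a @ v # b)"
    and heap_orientation_move_last:
      "(\<And>x. x \<in> set b \<Longrightarrow> (v, x) \<notin> heap_orientation u (a @ v # b)) \<Longrightarrow>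
         heap_orientation u (a @ b @ [v]) = heap_orientation u (a @ v # b)"
proof -
  \<comment> \<open>\<open>heap_orientation_iff\<close> tests the bond in the order of the pair, and
    the move reverses that order.\<close>
  have sym: "bond (u ! x) (u ! y) = bond (u ! y) (u ! x)"
    if "x \<in> set (a @ v # b)" "y \<in> set (a @ v # b)" for x y
    using that u unfolding p(2) by (intro bond_commute) auto
  have q: "distinct (v # a @ b)" "set (v # a @ b) = {..<length u}"
    "distinct (a @ b @ [v])" "set (a @ b @ [v]) = {..<length u}"
    using p by auto
  note iff = heap_orientation_iff[OF u p] heap_orientation_iff[OF u q(1,2)]
    heap_orientation_iff[OF u q(3,4)]
  show "heap_orientation u (v # a @ b) = heap_orientation u (a @ v # b)"
    if no: "\<And>x. x \<in> set a \<Longrightarrow> (x, v) \<notin> heap_orientation u (a @ v # b)"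
  proof -
    have "bond (u ! x) (u ! v) = 2 \<and> bond (u ! v) (u ! x) = 2" if "x \<in> set a" for x
      using no[OF that] that sym[of x v] by (auto simp: iff)
    then show ?thesis
      by (auto simp: iff set_eq_iff)
  qed
  show "heap_orientation u (a @ b @ [v]) = heap_orientation u (a @ v # b)"
    if no: "\<And>x. x \<in> set b \<Longrightarrow> (v, x) \<notin> heap_orientation u (a @ v # b)"
  proof -
    have "bond (u ! x) (u ! v) = 2 \<and> bond (u ! v) (u ! x) = 2" if "x \<in> set b" for x
      using no[OF that] that sym[of x v] by (auto simp: iff)
    then show ?thesis
      by (auto simp: iff set_eq_iff)
  qed
qed

text \<open>The first entry of an ordering is a source; moving it to the end is one conversion, so
  each unit rotation stays in the toric class.\<close>

lemma toric_ordering_rotate: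
  assumes "toric_ordering u p" shows "toric_ordering u (rotate k p)"
proof (induction k)
  case (Suc k)
  show ?case
  proof (cases "rotate k p")
    case (Cons v q)
    have vq: "distinct (v # q)" "set (v # q) = {..<length u}"
      and cl: "heap_orientation u (v # q) \<in> toric_class (word_graph u) (word_orientation u)"
      using Suc unfolding toric_ordering_def Cons by blast+
    have "source_to_sink (word_graph u) (heap_orientation u (v # q))
        (heap_orientation u (q @ [v]))"
      unfolding heap_orientation_def
      by (rule source_to_sink_rotate[OF vq(1) _ word_graph_facts(2,3)])
        (simp only: vq(2) word_graph_facts(1))
    then have "heap_orientation u (q @ [v]) \<in> toric_class (word_graph u) (word_orientation u)"
      by (rule toric_class_trans[OF cl r_into_equivclp])
    moreover have "rotate (Suc k) p = q @ [v]"
      by (simp add: Cons)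
    ultimately show ?thesis
      using vq by (simp add: toric_ordering_def)
  qed (use Suc in simp)
qed (use assms in simp)

lemma Ltor_toric_heap_eq:
  "Ltor (toric_heap u) = {cyclic_word (map (nth u) p) | p. toric_ordering u p}"
proof -
  have ext: "total_toric_extensions (toric_poset (word_graph u) (word_orientation u)) =
      {cyclic_word p | p. toric_ordering u p}"
    by (auto simp: total_toric_extensions_def toric_poset_def toric_ordering_def
        heap_orientation_def word_graph_facts)
  \<comment> \<open>\<open>Ltor\<close> admits every \<open>p\<close> whose cyclic word is a total
    extension; rotation invariance makes such a \<open>p\<close> a toric ordering itself.\<close>
  have "toric_ordering u p" if "toric_ordering u q" "cyclic_word p = cyclic_word q" for p q
    using cyclic_word_eqD[of q p] toric_ordering_rotate that by auto
  then show ?thesis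
    by (auto simp: Ltor_def toric_heap_def ext)
qed

lemma same_heap_orientation_comm_equiv:
  assumes u: "u \<in> lists S" and p: "distinct p" "set p = {..<length u}"
    and q: "distinct q" "set q = {..<length u}"
    and eq: "heap_orientation u p = heap_orientation u q"
  shows "cyclic_word (map (nth u) p) \<sim> cyclic_word (map (nth u) q)"
proof (intro cyclic_comm_equivI equivclp_short_braid_orderings)
  show "nth u ` set q \<subseteq> S"
    using u q by auto
  show "(i, j) \<in> ordering_orientation p \<longleftrightarrow> (i, j) \<in> ordering_orientation q"
    if "bond (u ! i) (u ! j) \<noteq> 2" for i j
    using that heap_orientation_iff[OF u p, of i j] heap_orientation_iff[OF u q, of i j]
    by (simp add: eq)
qed (use p q in auto)

section \<open>The two inclusions between \<open>Ltor\<close> and the cyclic commutativity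
  class\<close>

lemma cyclic_short_braid_Ltor:
  assumes u: "u \<in> lists S" and A: "A \<in> Ltor (toric_heap u)" and AB: "cyclic_short_braid A B"
  shows "B \<in> Ltor (toric_heap u)"
proof -
  obtain a b where ab: "A = cyclic_word a" "B = cyclic_word b" "short_braid a b"
    using AB by (auto simp: cyclic_short_braid_def)
  obtain p where p: "toric_ordering u p" "A = cyclic_word (map (nth u) p)"
    using A by (auto simp: Ltor_toric_heap_eq)
  obtain k where "a = rotate k (map (nth u) p)"
    using ab p cyclic_word_eqD by metis
  then have a: "a = map (nth u) (rotate k p)"
    by (simp add: rotate_map)
  obtain x y s t where xy: "a = x @ s # t # y" "b = x @ t # s # y" and st: "bond s t = 2"
    using ab by (auto simp: short_braid_iff)
  \<comment> \<open>The short braid is pulled back from letters to positions: \<open>i\<close> and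
    \<open>j\<close> are adjacent in the rotated ordering and carry the letters \<open>s\<close> and
    \<open>t\<close>.\<close>
  obtain x' i j y' where q: "rotate k p = x' @ i # j # y'"
    and m: "x = map (nth u) x'" "s = u ! i" "t = u ! j" "y = map (nth u) y'"
    using a xy by (auto simp: append_eq_map_conv Cons_eq_map_conv)
  have r: "distinct (x' @ i # j # y')" "set (x' @ i # j # y') = {..<length u}"
    using toric_ordering_rotate[OF p(1), of k] by (auto simp: toric_ordering_def q)
  then have r': "distinct (x' @ j # i # y')" "set (x' @ j # i # y') = {..<length u}"
    by auto
  have "i < length u" "j < length u"
    using r(2) by auto
  then have "bond t s = 2"
    using st m u bond_commute[of s t] by auto
  \<comment> \<open>The swapped positions carry commuting letters and form no edge, so the swap is
    invisible to the orientation.\<close>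
  then have "heap_orientation u (x' @ j # i # y') = heap_orientation u (x' @ i # j # y')"
    using heap_orientation_iff[OF u r] heap_orientation_iff[OF u r'] st m
    by (auto simp: set_eq_iff)
  then have "toric_ordering u (x' @ j # i # y')"
    using toric_ordering_rotate[OF p(1), of k] r' by (simp add: toric_ordering_def q)
  moreover have "b = map (nth u) (x' @ j # i # y')"
    by (simp add: xy m)
  ultimately show ?thesis
    unfolding Ltor_toric_heap_eq ab(2) by blast
qed

lemma cyclic_short_braid_sym: "cyclic_short_braid A B \<Longrightarrow> cyclic_short_braid B A"
  unfolding cyclic_short_braid_def using short_braid_sym by blast

lemma cyclic_word_in_Ltor: "cyclic_word u \<in> Ltor (toric_heap u)"
proof -
  \<comment> \<open>The identity ordering induces \<open>word_orientation u\<close> and spells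
    \<open>u\<close>.\<close>
  have "toric_ordering u [0..<length u]"
    by (auto simp: toric_ordering_def heap_orientation_def word_orientation_eq_restrict
        toric_class_def)
  then show ?thesis
    unfolding Ltor_toric_heap_eq by (smt (verit) map_nth mem_Collect_eq)
qed

text \<open>The property of an orientation carried along the toric class. It speaks of all orderings
  inducing \<open>\<omega>\<close>, so a convenient one can be chosen at each conversion.\<close>

definition orderings_comm_equiv :: "'a list \<Rightarrow> nat rel \<Rightarrow> bool" where
  "orderings_comm_equiv u \<omega> \<longleftrightarrow>
     (\<forall>p. distinct p \<and> set p = {..<length u} \<and> heap_orientation u p = \<omega> \<longrightarrow>
        cyclic_word (map (nth u) p) \<sim> cyclic_word u)"

(* An ordering whose induced orientation has v as a source can be rearranged by commutations so
   that v comes first, and then a rotation makes v the last vertex. *)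
lemma orderings_comm_equiv_source_to_sink:
  assumes u: "u \<in> lists S" and step: "source_to_sink (word_graph u) \<omega> \<omega>'"
  shows "orderings_comm_equiv u \<omega> \<longleftrightarrow> orderings_comm_equiv u \<omega>'"
proof -
  obtain v where v: "v < length u" "\<And>i. (i, v) \<notin> \<omega>"
    and \<omega>': "\<omega>' = {(a, b) \<in> \<omega>. a \<noteq> v} \<union> {(b, v) | b. (v, b) \<in> \<omega>}"
    using step by (auto simp: source_to_sink_def word_graph_facts)
  \<comment> \<open>No edge of \<open>\<omega>\<close> enters \<open>v\<close>, so the edges of
    \<open>\<omega>'\<close> into \<open>v\<close> are exactly the reversed ones, and turning them
    back recovers \<open>\<omega>\<close>.\<close>
  have \<omega>: "\<omega> = {(a, b) \<in> \<omega>'. b \<noteq> v} \<union> {(v, b) | b. (b, v) \<in> \<omega>'}"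
    using v by (auto simp: \<omega>')
  have sink: "(v, i) \<notin> \<omega>'" for i
    using v by (auto simp: \<omega>')
  have flip: "heap_orientation u (v # q) = \<omega> \<longleftrightarrow> heap_orientation u (q @ [v]) = \<omega>'"
    if "distinct (v # q)" for q
    unfolding heap_orientation_def
  proof
    show "restrict_orientation (word_graph u) (ordering_orientation (q @ [v])) = \<omega>'"
      if "restrict_orientation (word_graph u) (ordering_orientation (v # q)) = \<omega>"
      by (simp only: restrict_ordering_rotate(1)[OF \<open>distinct (v # q)\<close>] that \<omega>'[symmetric])
    show "restrict_orientation (word_graph u) (ordering_orientation (v # q)) = \<omega>"
      if "restrict_orientation (word_graph u) (ordering_orientation (q @ [v])) = \<omega>'"
      by (simp only: restrict_ordering_rotate(2)[OF \<open>distinct (v # q)\<close>] that \<omega>[symmetric])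
  qed
  show ?thesis
  proof
    assume C: "orderings_comm_equiv u \<omega>"
    show "orderings_comm_equiv u \<omega>'"
      unfolding orderings_comm_equiv_def
    proof (intro allI impI)
      fix p assume p: "distinct p \<and> set p = {..<length u} \<and> heap_orientation u p = \<omega>'"
      then obtain a b where ab: "p = a @ v # b"
        using v(1) by (metis lessThan_iff split_list)
      \<comment> \<open>In \<open>\<omega>'\<close> the vertex \<open>v\<close> is a sink, so it is
        commuted to the last place and then rotated to the front.\<close>
      then have last: "heap_orientation u ((a @ b) @ [v]) = \<omega>'"
        using heap_orientation_move_last[OF u, of a v b] p sink by simp
      then have "heap_orientation u (v # a @ b) = \<omega>"
        using flip p ab by auto
      moreover have "distinct (v # a @ b)" "set (v # a @ b) = {..<length u}"
        using p ab by auto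
      ultimately have "cyclic_word (map (nth u) (v # a @ b)) \<sim> cyclic_word u"
        using C unfolding orderings_comm_equiv_def by blast
      moreover have "cyclic_word (map (nth u) p) \<sim> cyclic_word (map (nth u) ((a @ b) @ [v]))"
        using p ab last by (intro same_heap_orientation_comm_equiv[OF u]) auto
      moreover have "cyclic_word (map (nth u) ((a @ b) @ [v])) =
          cyclic_word (map (nth u) (v # a @ b))"
        using cyclic_word_snoc[of "map (nth u) (a @ b)"] by simp
      ultimately show "cyclic_word (map (nth u) p) \<sim> cyclic_word u"
        by (metis equivclp_trans)
    qed
  next
    assume C: "orderings_comm_equiv u \<omega>'"
    show "orderings_comm_equiv u \<omega>"
      unfolding orderings_comm_equiv_def
    proof (intro allI impI)
      fix p assume p: "distinct p \<and> set p = {..<length u} \<and> heap_orientation u p = \<omega>"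
      then obtain a b where ab: "p = a @ v # b"
        using v(1) by (metis lessThan_iff split_list)
      then have first: "heap_orientation u (v # a @ b) = \<omega>"
        using heap_orientation_move_first[OF u, of a v b] p v(2) by simp
      then have "heap_orientation u ((a @ b) @ [v]) = \<omega>'"
        using flip p ab by auto
      moreover have "distinct ((a @ b) @ [v])" "set ((a @ b) @ [v]) = {..<length u}"
        using p ab by auto
      ultimately have "cyclic_word (map (nth u) ((a @ b) @ [v])) \<sim> cyclic_word u"
        using C unfolding orderings_comm_equiv_def by blast
      moreover have "cyclic_word (map (nth u) p) \<sim> cyclic_word (map (nth u) (v # a @ b))"
        using p ab first by (intro same_heap_orientation_comm_equiv[OF u]) auto
      moreover have "cyclic_word (map (nth u) ((a @ b) @ [v])) =
          cyclic_word (map (nth u) (v # a @ b))"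
        using cyclic_word_snoc[of "map (nth u) (a @ b)"] by simp
      ultimately show "cyclic_word (map (nth u) p) \<sim> cyclic_word u"
        by (metis equivclp_trans)
    qed
  qed
qed

lemma Ltor_toric_heap:
  assumes u: "u \<in> lists S"
  shows "Ltor (toric_heap u) = cyclic_comm_class (cyclic_word u)"
proof (intro equalityI subsetI)
  have base: "orderings_comm_equiv u (word_orientation u)"
    unfolding orderings_comm_equiv_def
  proof (intro allI impI)
    fix p
    assume "distinct p \<and> set p = {..<length u} \<and> heap_orientation u p = word_orientation u"
    then have "cyclic_word (map (nth u) p) \<sim> cyclic_word (map (nth u) [0..<length u])"
      by (intro same_heap_orientation_comm_equiv[OF u])
        (auto simp: word_orientation_eq_restrict heap_orientation_def)
    then show "cyclic_word (map (nth u) p) \<sim> cyclic_word u"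
      by (simp add: map_nth)
  qed
  \<comment> \<open>The equivalence closure also runs conversions backwards, which is why the
    invariance was proved as an equivalence.\<close>
  have in_class: "orderings_comm_equiv u \<omega>"
    if "\<omega> \<in> toric_class (word_graph u) (word_orientation u)" for \<omega>
  proof -
    have "equivclp (source_to_sink (word_graph u)) (word_orientation u) \<omega>"
      using that by (auto simp: toric_class_def intro: equivclp_sym)
    then show ?thesis
      by (induction rule: equivclp_induct)
        (use base orderings_comm_equiv_source_to_sink[OF u] in blast)+
  qed
  fix A assume "A \<in> Ltor (toric_heap u)"
  then show "A \<in> cyclic_comm_class (cyclic_word u)"
    using in_class
    by (auto simp: Ltor_toric_heap_eq cyclic_comm_class_def toric_ordering_def
        orderings_comm_equiv_def)
next
  fix A assume "A \<in> cyclic_comm_class (cyclic_word u)"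
  then have "cyclic_word u \<sim> A"
    by (auto simp: cyclic_comm_class_def intro: equivclp_sym)
  then show "A \<in> Ltor (toric_heap u)"
  proof (induction rule: equivclp_induct)
    case base
    show ?case by (rule cyclic_word_in_Ltor)
  next
    case (step y z)
    then show ?case
      using cyclic_short_braid_Ltor[OF u] cyclic_short_braid_sym by blast
  qed
qed

section \<open>Torically reduced words and the set \<open>Rtor\<close>\<close>

lemma cyclic_comm_class_eq:
  "A \<in> cyclic_comm_class B \<Longrightarrow> cyclic_comm_class A = cyclic_comm_class B"
  unfolding cyclic_comm_class_def by (auto intro: equivclp_trans equivclp_sym)

text \<open>A braid between cyclic words is a rotation, a braid and a further rotation of words, so
  \<open>u\<close> is reachable from \<open>v\<close> by the moves under which \<open>v\<close>
  stays reduced.\<close>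

lemma torically_reduced_word_cyclic_braid_equiv:
  assumes v: "torically_reduced_word v" and uv: "cyclic_word v \<approx> cyclic_word u"
  shows "torically_reduced_word u"
proof -
  define R where "R = (\<lambda>x y. (\<exists>k. y = rotate k x) \<or> braid x y)\<^sup>*\<^sup>*"
  have same: "R x y" if "cyclic_word x = cyclic_word y" for x y
    using cyclic_word_eqD[OF that] unfolding R_def by blast
  \<comment> \<open>All representatives of \<open>B\<close> are treated at once, since the next
    cyclic braid picks its own.\<close>
  have "\<forall>x. B = cyclic_word x \<longrightarrow> R v x" if "cyclic_word v \<approx> B" for B
    using that
  proof (induction rule: equivclp_induct)
    case base
    then show ?case
      using same by blast
  next
    case (step A B)
    \<comment> \<open>A step of the closure may go either way; symmetry of \<open>braid\<close>
      orients it from \<open>A\<close> to \<open>B\<close>.\<close>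
    then obtain a b where ab: "A = cyclic_word a" "B = cyclic_word b" "braid a b"
      unfolding cyclic_braid_def using braid_sym by blast
    then have "R v a"
      using step.IH by blast
    moreover have "R a b"
      unfolding R_def using ab(3) by blast
    moreover have "R b x" if "B = cyclic_word x" for x
      using same that ab(2) by simp
    moreover have "R x z" if "R x y" "R y z" for x y z
      using that unfolding R_def by (rule rtranclp_trans)
    ultimately show ?case
      by blast
  qed
  then have "R v u"
    using uv by blast
  moreover have "u \<in> lists S"
    using \<open>R v u\<close> v unfolding R_def
    by (induction rule: rtranclp_induct)
      (auto simp: torically_reduced_word_def rotate_in_lists dest: braid_in_lists)
  ultimately show ?thesis
    using v unfolding torically_reduced_word_def R_def by (meson rtranclp_trans)
qed

text \<open>Each generator is its own inverse, so inverses in \<open>generate\<close> are again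
  single letters, and products become concatenations.\<close>

lemma exists_word:
  assumes "w \<in> carrier W" shows "\<exists>u \<in> lists S. word_prod u = w"
proof -
  have closed: "word_prod u \<in> carrier W" if "u \<in> lists S" for u
    using that generators_subset by (induction u) (auto simp: word_prod_def)
  have append: "word_prod (u @ v) = word_prod u \<otimes> word_prod v"
    if "u \<in> lists S" "v \<in> lists S" for u v
    using that
  proof (induction u)
    case Nil
    then show ?case using closed by (simp add: word_prod_def)
  next
    case (Cons s u)
    then show ?case
      using closed[of u] closed[of v] generators_subset by (auto simp: word_prod_def m_assoc)
  qed
  have single: "word_prod [s] = s" if "s \<in> S" for s
    using that generators_subset by (auto simp: word_prod_def)
  have "w \<in> generate W S"
    using assms generated by simp
  then show ?thesis
  proof (induction rule: generate.induct)
    case one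
    show ?case
      by (intro bexI[of _ "[]"]) (auto simp: word_prod_def)
  next
    case (incl s)
    then show ?case
      using single by (intro bexI[of _ "[s]"]) auto
  next
    case (inv s)
    then have "inv s = s"
      using generators_subset generators_involutive by (auto intro!: inv_equality)
    with inv show ?case
      using single by (intro bexI[of _ "[s]"]) auto
  next
    case (eng g h)
    then obtain u v where "u \<in> lists S" "v \<in> lists S" "word_prod u = g" "word_prod v = h"
      by blast
    then show ?case
      using append by (intro bexI[of _ "u @ v"]) auto
  qed
qed

lemma reduced_words_nonempty:
  assumes "w \<in> carrier W" shows "reduced_words w \<noteq> {}"
proof -
  obtain u where "u \<in> lists S \<and> word_prod u = w"
    using exists_word[OF assms] by blast
  then obtain v where "v \<in> lists S \<and> word_prod v = w"
    "\<forall>y. y \<in> lists S \<and> word_prod y = w \<longrightarrow> length v \<le> length y"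
    using ex_has_least_nat[of "\<lambda>u. u \<in> lists S \<and> word_prod u = w" u length] by blast
  then have "v \<in> reduced_words w"
    by (auto simp: reduced_words_def reduced_def)
  then show ?thesis by blast
qed

text \<open>Needed to pass from every word to some word in the final equivalence.\<close>

lemma Rtor_words_nonempty:
  assumes "w \<in> carrier W" shows "Rtor_words w \<noteq> {}"
proof -
  obtain v where "v \<in> reduced_words w"
    using reduced_words_nonempty[OF assms] by blast
  moreover from this have "v \<in> lists S"
    by (simp add: reduced_words_def reduced_def)
  ultimately have "v \<in> Rtor_words w"
    unfolding Rtor_words_def Rtor_def by (auto intro: equivclp_refl)
  then show ?thesis by blast
qed

lemma Rtor_words_torically_reduced:
  assumes "torically_reduced w" and "u \<in> Rtor_words w"
  shows "torically_reduced_word u"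
proof -
  obtain u' v where "cyclic_word u = cyclic_word u'" "v \<in> reduced_words w"
    "cyclic_word u' \<approx> cyclic_word v"
    using assms(2) by (auto simp: Rtor_words_def Rtor_def)
  then have "cyclic_word v \<approx> cyclic_word u"
    by (simp add: equivclp_sym)
  then show ?thesis
    using torically_reduced_word_cyclic_braid_equiv assms(1) \<open>v \<in> reduced_words w\<close>
    by (auto simp: torically_reduced_def)
qed

section \<open>Equivalence of the three conditions\<close>

theorem TFC_characterization:
  assumes carrier: "w \<in> carrier W" and tor: "torically_reduced w"
  shows "(TFC w \<longleftrightarrow> torically_order_theoretic (Rtor w))
    \<and> (torically_order_theoretic (Rtor w) \<longleftrightarrow>
         (\<exists>u \<in> Rtor_words w. Rtor w = Ltor (toric_heap u)))
    \<and> ((\<exists>u \<in> Rtor_words w. Rtor w = Ltor (toric_heap u)) \<longleftrightarrow>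
       (\<forall>u \<in> Rtor_words w. Rtor w = Ltor (toric_heap u)))"
proof -
  let ?some = "\<exists>u \<in> Rtor_words w. Rtor w = Ltor (toric_heap u)"
  have TFC: "TFC w \<longleftrightarrow> (\<exists>u \<in> lists S. Rtor w = Ltor (toric_heap u))"
    using tor by (auto simp: TFC_def Ltor_toric_heap)
  \<comment> \<open>The cyclic word of \<open>u\<close> lies in \<open>Ltor (toric_heap u)\<close>,
    so equality with \<open>Rtor w\<close> puts \<open>u\<close> into
    \<open>Rtor_words w\<close>.\<close>
  have some: "(\<exists>u \<in> lists S. Rtor w = Ltor (toric_heap u)) \<longleftrightarrow> ?some"
    using cyclic_word_in_Ltor by (auto simp: Rtor_words_def)
  have order: "torically_order_theoretic (Rtor w) \<longleftrightarrow> ?some"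
  proof
    assume "torically_order_theoretic (Rtor w)"
    then show ?some
      using some by (auto simp: torically_order_theoretic_def torically_reduced_word_def)
  next
    assume ?some
    then show "torically_order_theoretic (Rtor w)"
      using Rtor_words_torically_reduced[OF tor] by (auto simp: torically_order_theoretic_def)
  qed
  have every: "Rtor w = Ltor (toric_heap u)" if some_u: ?some and u: "u \<in> Rtor_words w" for u
  proof -
    have mem: "v \<in> lists S \<and> cyclic_word v \<in> Rtor w" if "v \<in> Rtor_words w" for v
      using that unfolding Rtor_words_def by blast
    obtain u' where u': "u' \<in> Rtor_words w" "Rtor w = Ltor (toric_heap u')"
      using some_u by blast
    then have Rtor: "Rtor w = cyclic_comm_class (cyclic_word u')"
      using Ltor_toric_heap mem by metis
    \<comment> \<open>\<open>Rtor w\<close> is now one commutativity class, and a class is generated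
      by any of its members, in particular by the cyclic word of \<open>u\<close>.\<close>
    then have "cyclic_comm_class (cyclic_word u) = Rtor w"
      using cyclic_comm_class_eq mem[OF u] by metis
    then show ?thesis
      using Ltor_toric_heap mem[OF u] by metis
  qed
  show ?thesis
    using TFC some order every Rtor_words_nonempty[OF carrier] by blast
qed

end

theorem mainTheorem5:
  fixes W :: "('a, 'b) monoid_scheme" and S :: "'a set" and w :: 'a
  assumes "coxeter_system W S"
    and "w \<in> carrier W"
    and "coxeter_system.torically_reduced W S w"
  shows "(coxeter_system.TFC W S w \<longleftrightarrow>
            coxeter_system.torically_order_theoretic W S (coxeter_system.Rtor W S w))
       \<and> (coxeter_system.torically_order_theoretic W S (coxeter_system.Rtor W S w) \<longleftrightarrow>
            (\<exists>u \<in> coxeter_system.Rtor_words W S w.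
               coxeter_system.Rtor W S w = Ltor (coxeter_system.toric_heap W S u)))
       \<and> ((\<exists>u \<in> coxeter_system.Rtor_words W S w.
             coxeter_system.Rtor W S w = Ltor (coxeter_system.toric_heap W S u)) \<longleftrightarrow>
          (\<forall>u \<in> coxeter_system.Rtor_words W S w.
             coxeter_system.Rtor W S w = Ltor (coxeter_system.toric_heap W S u)))"
  by (rule coxeter_system.TFC_characterization[OF assms])

end
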